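(* Let $d\ge 1$ be an integer. For every $(d-1)$-degenerate graph $G$ on $n$ vertices and every integer $k \geq 2d$, we have $\mathrm{diam}(\mathcal{C}_k(G)) \leq d n$. Even stronger: for any two proper $k$-colorings $\alpha$ and $\beta$ of $G$ there exists a path in $\mathcal{C}_k(G)$ from $\alpha$ to $\beta$ (that is, a sequence of proper $k$-colorings starting at $\alpha$ and ending at $\beta$ in which consecutive colorings differ on exactly one vertex) along which every vertex of $G$ is recolored at most $d$ times.
   Context: Graphs are finite and simple. A proper $k$-coloring of $G=(V,E)$ is a function $f:V\to\{1,\dots,k\}$ such that $f(x)\ne f(y)$ for every edge $xy\in E$. The $k$-recoloring graph $\mathcal{C}_k(G)$ is the graph whose vertices are the proper $k$-colorings of $G$, two colorings being adjacent if they differ on exactly one vertex of $G$ (colorings equal up to color permutation are distinct vertices of $\mathcal{C}_k(G)$). The diameter $\mathrm{diam}(\mathcal{C}_k(G))$ is the maximum distance between two vertices of $\mathcal{C}_k(G)$, the distance being infinite when there is no path. Along a path in $\mathcal{C}_k(G)$, each step recolors exactly one vertex, namely the one on which the two consecutive colorings differ. A graph is $(d-1)$-degenerate if every non-empty subgraph has a vertex of degree at most $d-1$. *)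

theory Defs
  imports "Graph_Theory.Graph_Theory" "HOL-Library.FuncSet"
begin

text \<open>
  A finite simple graph is a symmetric, loop-free digraph without parallel arcs
  (locale \<^locale>\<open>graph\<close>): an edge is a pair of opposite arcs, and the degree of a
  vertex is its out-degree.
\<close>

definition degenerate :: "nat \<Rightarrow> ('a, 'b) pre_digraph \<Rightarrow> bool" where
  "degenerate m G \<longleftrightarrow>
    (\<forall>H. graph H \<and> subgraph H G \<and> verts H \<noteq> {} \<longrightarrow>
      (\<exists>v \<in> verts H. out_degree H v \<le> m))"

text \<open>
  Colorings are extensional (\<^const>\<open>undefined\<close> outside the vertex set), so that two
  colorings are equal iff they agree on all vertices.
\<close>

definition proper_colorings :: "nat \<Rightarrow> ('a, 'b) pre_digraph \<Rightarrow> ('a \<Rightarrow> nat) set" where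
  "proper_colorings k G =
    {f \<in> verts G \<rightarrow>\<^sub>E {1..k}. \<forall>x y. x \<rightarrow>\<^bsub>G\<^esub> y \<longrightarrow> f x \<noteq> f y}"

definition recoloring_graph ::
  "nat \<Rightarrow> ('a, 'b) pre_digraph \<Rightarrow> ('a \<Rightarrow> nat, ('a \<Rightarrow> nat) \<times> ('a \<Rightarrow> nat)) pre_digraph" where
  "recoloring_graph k G =
    \<lparr> verts = proper_colorings k G,
      arcs = {(f, g). f \<in> proper_colorings k G \<and> g \<in> proper_colorings k G \<and>
                      (\<exists>!v. v \<in> verts G \<and> f v \<noteq> g v)},
      tail = fst,
      head = snd \<rparr>"

lemma graph_recoloring_graph:
  assumes "graph G"
  shows "graph (recoloring_graph k G)"
proof -
  interpret G: graph G by fact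
  have fin: "finite (proper_colorings k G)"
    unfolding proper_colorings_def
    by (rule finite_subset[of _ "verts G \<rightarrow>\<^sub>E {1..k}"]) (auto intro: finite_PiE)
  have "arcs (recoloring_graph k G) \<subseteq> proper_colorings k G \<times> proper_colorings k G"
    by (auto simp: recoloring_graph_def)
  then have fin': "finite (arcs (recoloring_graph k G))"
    using fin finite_subset by blast
  show ?thesis
  proof
    show "symmetric (recoloring_graph k G)"
      unfolding symmetric_conv by (fastforce simp: recoloring_graph_def)
  qed (use fin fin' in \<open>auto simp: recoloring_graph_def arc_to_ends_def\<close>)
qed

text \<open>
  The distance of two vertices is the least length of a walk between them, i.e. its
  least cost when all arcs have cost 1; it is \<^term>\<open>\<infinity> :: ereal\<close> if there is no walk.
\<close>

definition diam :: "('a, 'b) pre_digraph \<Rightarrow> ereal" where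
  "diam G = (SUP u \<in> verts G. SUP v \<in> verts G. wf_digraph.\<mu> G (\<lambda>_. 1) u v)"

text \<open>A walk in the recoloring graph is given by its list of arcs (recoloring steps).\<close>

definition recolor_count :: "'a \<Rightarrow> (('a \<Rightarrow> nat) \<times> ('a \<Rightarrow> nat)) list \<Rightarrow> nat" where
  "recolor_count v p = length (filter (\<lambda>(f, g). f v \<noteq> g v) p)"

end

theory Submission
  imports Defs
begin

text \<open>
  The path is built by induction on the number of vertices. A degenerate graph has a vertex \<open>v\<close>
  with at most \<open>d - 1\<close> neighbors, and by induction \<open>G - v\<close> can be recolored with every vertex
  recolored at most \<open>d\<close> times; so the neighbors of \<open>v\<close> are recolored at most \<open>d (d - 1)\<close> times
  altogether. This recoloring is carried out in \<open>G\<close> as well, and \<open>v\<close> is moved out of the way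
  whenever one of its neighbors is about to receive the color of \<open>v\<close>.

  The point is to choose the new color of \<open>v\<close> with foresight. It has to differ from the at most
  \<open>d - 1\<close> current colors of the neighbors and from the old color of \<open>v\<close>, which the neighbor is
  about to take. With \<open>2 d\<close> colors there is still room to avoid \<open>d - 1\<close> further ones, and one
  avoids the colors that the neighbors take in their next \<open>d - 1\<close> recolorings. Hence \<open>v\<close> is forced
  to move at most once in every \<open>d\<close> consecutive recolorings of its neighbors
  (\<open>extend_recoloring\<close>), that is, at most \<open>d - 1\<close> times. At the end all neighbors of \<open>v\<close> have
  their target colors, so one more step gives \<open>v\<close> its own target color: at most \<open>d\<close> steps for
  \<open>v\<close>, and unchanged numbers for the other vertices (\<open>recoloring_sequence_exists\<close>).

  A path on which each of the \<open>n\<close> vertices is recolored at most \<open>d\<close> times has length at most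
  \<open>d n\<close>, which gives the bound on the diameter.
\<close>

section \<open>Recoloring sequences\<close>

text \<open>
  A recoloring is described by its steps \<open>(w, a)\<close>, read as: give vertex \<open>w\<close> the color \<open>a\<close>. Unlike a
  list of colorings, such a list keeps its meaning when a vertex is added to the vertex set \<open>S\<close>.
  Colorings are total functions whose values outside \<open>S\<close> do not matter. A step must
  change the color of \<open>w\<close>, because consecutive vertices of a path of colorings are distinct.
\<close>

fun legal :: "nat \<Rightarrow> ('a \<Rightarrow> 'a \<Rightarrow> bool) \<Rightarrow> 'a set \<Rightarrow> ('a \<Rightarrow> nat) \<Rightarrow> ('a \<times> nat) list \<Rightarrow> bool" where
  "legal k E S f [] \<longleftrightarrow> True"
| "legal k E S f ((w, a) # s) \<longleftrightarrow>
    w \<in> S \<and> a \<in> {1..k} \<and> f w \<noteq> a \<and> (\<forall>u\<in>S. E w u \<longrightarrow> f u \<noteq> a) \<and> legal k E S (f(w := a)) s"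

fun run :: "('a \<Rightarrow> nat) \<Rightarrow> ('a \<times> nat) list \<Rightarrow> 'a \<Rightarrow> nat" where
  "run f [] = f"
| "run f ((w, a) # s) = run (f(w := a)) s"

abbreviation times_recolored :: "('a \<times> nat) list \<Rightarrow> 'a \<Rightarrow> nat" where
  "times_recolored s v \<equiv> count_list (map fst s) v"

text \<open>
  The colors that the neighbors of \<open>v\<close> receive, in order of time: these are the events that can
  force \<open>v\<close> to be recolored.
\<close>

definition neighbor_targets :: "('a \<Rightarrow> 'a \<Rightarrow> bool) \<Rightarrow> 'a \<Rightarrow> ('a \<times> nat) list \<Rightarrow> nat list" where
  "neighbor_targets E v s = map snd (filter (\<lambda>(w, a). E v w) s)"

lemma legal_append:
  "legal k E S f (s @ s') \<longleftrightarrow> legal k E S f s \<and> legal k E S (run f s) s'"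
  by (induction s arbitrary: f) auto

lemma run_append: "run f (s @ s') = run (run f s) s'"
  by (induction s arbitrary: f) auto

lemma legal_vertices: "legal k E S f s \<Longrightarrow> fst ` set s \<subseteq> S"
  by (induction k E S f s rule: legal.induct) auto

lemma run_outside: "x \<notin> fst ` set s \<Longrightarrow> run f s x = f x"
  by (induction s arbitrary: f) auto

lemma length_neighbor_targets_le:
  assumes "fst ` set s \<subseteq> S" "finite S" "card {u \<in> S. E v u} \<le> m"
    and "\<And>u. u \<in> S \<Longrightarrow> times_recolored s u \<le> d"
  shows "length (neighbor_targets E v s) \<le> m * d"
proof -
  let ?N = "{u \<in> S. E v u}" and ?s = "filter (\<lambda>(w, a). E v w) s"
  have "length (neighbor_targets E v s) = length (map fst ?s)"
    by (simp add: neighbor_targets_def)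
  also have "\<dots> = (\<Sum>u\<in>?N. times_recolored ?s u)"
    by (rule sum_count_set[symmetric]) (use assms in auto)
  also have "\<dots> \<le> (\<Sum>u\<in>?N. d)"
  proof (rule sum_mono)
    fix u assume "u \<in> ?N"
    have "times_recolored ?s u \<le> times_recolored s u"
      by (induction s) auto
    with \<open>u \<in> ?N\<close> assms(4)[of u] show "times_recolored ?s u \<le> d" by simp
  qed
  also have "\<dots> \<le> m * d"
    using assms(3) by simp
  finally show ?thesis .
qed

section \<open>Inserting a vertex of small degree\<close>

lemma exists_color_outside:
  fixes k :: nat
  assumes "finite A" "card A < k"
  obtains c where "c \<in> {1..k}" "c \<notin> A"
proof -
  have "\<not> {1..k} \<subseteq> A"
    using card_mono[OF assms(1), of "{1..k}"] assms(2) by auto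
  then show ?thesis using that by blast
qed

text \<open>
  Every forced recoloring of \<open>v\<close> pays for itself with \<open>d\<close> recolorings of neighbors. To make this an
  invariant for induction along \<open>s\<close>, the number \<open>p\<close> records for how many of the coming neighbor
  recolorings the present color of \<open>v\<close> is known to be safe. These \<open>p\<close> events force nothing and
  are subtracted; the summand \<open>d - 1\<close> accounts for the last forced recoloring, which may be
  followed by fewer than \<open>d - 1\<close> further events. If the color is safe until the end, the bound
  leaves less than \<open>d\<close> for \<open>times_recolored s' v * d\<close>, so \<open>v\<close> never moves.

  The colorings \<open>f\<close> and \<open>g\<close> are kept apart because they disagree at \<open>v\<close> as soon as \<open>v\<close> has moved.
\<close>

lemma extend_recoloring:
  assumes "symp E" "finite S" "v \<notin> S" "card {u \<in> S. E v u} \<le> d - 1" "d \<ge> 1" "2 * d \<le> k"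
    and "legal k E S g s" "\<forall>x\<in>S. f x = g x"
    and "p \<le> length (neighbor_targets E v s)" "f v \<notin> set (take p (neighbor_targets E v s))"
  shows "\<exists>s'. legal k E (insert v S) f s' \<and> (\<forall>x\<in>S. run f s' x = run g s x) \<and>
           (\<forall>u\<in>S. times_recolored s' u = times_recolored s u) \<and>
           times_recolored s' v * d + p \<le> length (neighbor_targets E v s) + (d - 1)"
  using assms(7-)
proof (induction s arbitrary: f g p)
  case Nil
  then show ?case by (intro exI[of _ "[]"]) (auto simp: neighbor_targets_def)
next
  case (Cons step s)
  obtain w a where step: "step = (w, a)" by (cases step)
  let ?t = "neighbor_targets E v s"
  let ?N = "{u \<in> S. E v u}"
  have w: "w \<in> S" "a \<in> {1..k}" "g w \<noteq> a" "\<forall>u\<in>S. E w u \<longrightarrow> g u \<noteq> a" "legal k E S (g(w := a)) s"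
    using Cons.prems(1) step by auto
  have "w \<noteq> v" using w(1) \<open>v \<notin> S\<close> by auto
  have sym: "E w v \<longleftrightarrow> E v w" using \<open>symp E\<close> by (auto dest: sympD)
  have targets: "neighbor_targets E v (step # s) = (if E v w then a # ?t else ?t)"
    by (simp add: neighbor_targets_def step)
  show ?case
  proof (cases "E v w \<and> f v = a")
    case False
    \<comment> \<open>The step does not conflict with \<open>v\<close>; it uses up one safe event if \<open>w\<close> is a neighbor.
        For \<open>p = 0\<close> the truncated \<open>p - 1 = 0\<close> is the right value.\<close>
    define q where "q = (if E v w then p - 1 else p)"
    have q: "q \<le> length ?t" "f v \<notin> set (take q ?t)"
      using Cons.prems(3,4) False by (auto simp: targets q_def take_Cons' split: if_splits)
    have agree: "\<forall>x\<in>S. (f(w := a)) x = (g(w := a)) x"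
      using Cons.prems(2) by simp
    obtain s' where s': "legal k E (insert v S) (f(w := a)) s'"
      "\<forall>x\<in>S. run (f(w := a)) s' x = run (g(w := a)) s x"
      "\<forall>u\<in>S. times_recolored s' u = times_recolored s u"
      "times_recolored s' v * d + q \<le> length ?t + (d - 1)"
      using Cons.IH[OF w(5) agree, of q] q \<open>w \<noteq> v\<close> by (metis fun_upd_other)
    show ?thesis
      by (rule exI[of _ "(w, a) # s'"])
        (use s' w Cons.prems(2) False sym \<open>w \<noteq> v\<close> in
          \<open>auto simp: step targets[unfolded step] q_def split: if_splits\<close>)
  next
    case True
    then have "p = 0" using Cons.prems(4) by (cases p) (auto simp: targets)
    \<comment> \<open>The colors to avoid: the one that \<open>w\<close> takes and \<open>v\<close> gives up, the current ones of the
        neighbors, and the next \<open>d - 1\<close> targets after this step.\<close>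
    let ?A = "insert a (f ` ?N \<union> set (take (d - 1) ?t))"
    have "card ?A \<le> Suc (card (f ` ?N \<union> set (take (d - 1) ?t)))"
      by (rule card_insert_le_m1) auto
    also have "\<dots> \<le> Suc (card (f ` ?N) + card (set (take (d - 1) ?t)))"
      using card_Un_le by auto
    also have "\<dots> \<le> Suc ((d - 1) + (d - 1))"
    proof -
      have "card (f ` ?N) \<le> d - 1"
        using card_image_le[of ?N f] \<open>finite S\<close> assms(4) by simp
      moreover have "card (set (take (d - 1) ?t)) \<le> d - 1"
        using card_length[of "take (d - 1) ?t"] by simp
      ultimately show ?thesis by simp
    qed
    finally have "card ?A < k" using \<open>d \<ge> 1\<close> \<open>2 * d \<le> k\<close> by simp
    then obtain c where c: "c \<in> {1..k}" "c \<notin> ?A"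
      using exists_color_outside[of ?A k] \<open>finite S\<close> by auto
    define q where "q = min (d - 1) (length ?t)"
    have q: "q \<le> length ?t" "(f(v := c, w := a)) v \<notin> set (take q ?t)"
      using c(2) \<open>w \<noteq> v\<close> by (auto simp: q_def min_def split: if_splits)
    have agree: "\<forall>x\<in>S. (f(v := c, w := a)) x = (g(w := a)) x"
      using Cons.prems(2) \<open>v \<notin> S\<close> by auto
    obtain s' where s': "legal k E (insert v S) (f(v := c, w := a)) s'"
      "\<forall>x\<in>S. run (f(v := c, w := a)) s' x = run (g(w := a)) s x"
      "\<forall>u\<in>S. times_recolored s' u = times_recolored s u"
      "times_recolored s' v * d + q \<le> length ?t + (d - 1)"
      using Cons.IH[OF w(5) agree q] by blast
    have "(times_recolored s' v + 1) * d \<le> length ?t + d"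
    proof (cases "d - 1 \<le> length ?t")
      case True
      then show ?thesis using s'(4) by (simp add: q_def)
    next
      \<comment> \<open>Fewer than \<open>d - 1\<close> events remain, so the new color is safe until the end.\<close>
      case False
      then have "times_recolored s' v * d < 1 * d"
        using s'(4) \<open>d \<ge> 1\<close> unfolding q_def by linarith
      then have "times_recolored s' v = 0" unfolding mult_less_cancel2 by simp
      then show ?thesis by simp
    qed
    then have bound: "times_recolored ((v, c) # (w, a) # s') v * d + p
        \<le> length (neighbor_targets E v (step # s)) + (d - 1)"
      using \<open>p = 0\<close> True \<open>w \<noteq> v\<close> \<open>d \<ge> 1\<close> by (simp add: targets)
    have "legal k E (insert v S) f ((v, c) # (w, a) # s')"
      using s'(1) c True w Cons.prems(2) \<open>w \<noteq> v\<close> \<open>v \<notin> S\<close> by auto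
    then show ?thesis
      using s'(2,3) bound \<open>v \<notin> S\<close>
      by (intro exI[of _ "(v, c) # (w, a) # s'"]) (auto simp: step)
  qed
qed

section \<open>Degenerate graphs\<close>

definition proper_on :: "nat \<Rightarrow> ('a \<Rightarrow> 'a \<Rightarrow> bool) \<Rightarrow> 'a set \<Rightarrow> ('a \<Rightarrow> nat) \<Rightarrow> bool" where
  "proper_on k E S f \<longleftrightarrow> f ` S \<subseteq> {1..k} \<and> (\<forall>x\<in>S. \<forall>y\<in>S. E x y \<longrightarrow> f x \<noteq> f y)"

lemma proper_on_subset: "proper_on k E S f \<Longrightarrow> T \<subseteq> S \<Longrightarrow> proper_on k E T f"
  unfolding proper_on_def by blast

text \<open>
  The vertex of small degree is put back last. Its neighbors are recolored at most \<open>(d - 1) d\<close> times,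
  so \<open>extend_recoloring\<close> with \<open>p = 0\<close> recolors it \<open>R\<close> times with \<open>R d \<le> (d - 1) d + (d - 1) < d\<^sup>2\<close>. Thus
  \<open>R < d\<close>, which leaves one step for moving it to its final color.
\<close>

lemma recoloring_sequence_exists:
  assumes "symp E" "finite S" "d \<ge> 1" "2 * d \<le> k"
    and "\<And>T. T \<subseteq> S \<Longrightarrow> T \<noteq> {} \<Longrightarrow> \<exists>v\<in>T. card {u \<in> T. E v u} \<le> d - 1"
    and "proper_on k E S \<alpha>" "proper_on k E S \<beta>"
  shows "\<exists>s. legal k E S \<alpha> s \<and> (\<forall>x\<in>S. run \<alpha> s x = \<beta> x) \<and> (\<forall>v\<in>S. times_recolored s v \<le> d)"
  using assms(2,5-)
proof (induction S rule: finite_psubset_induct)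
  case (psubset S)
  show ?case
  proof (cases "S = {}")
    case True
    then show ?thesis by (intro exI[of _ "[]"]) simp
  next
    case False
    then obtain v where v: "v \<in> S" "card {u \<in> S. E v u} \<le> d - 1"
      using psubset.prems(1)[of S] by auto
    define S' where "S' = S - {v}"
    have S': "S = insert v S'" "v \<notin> S'" "finite S'" "S' \<subset> S"
      using v(1) psubset.hyps by (auto simp: S'_def)
    have "\<exists>s. legal k E S' \<alpha> s \<and> (\<forall>x\<in>S'. run \<alpha> s x = \<beta> x) \<and> (\<forall>u\<in>S'. times_recolored s u \<le> d)"
    proof (rule psubset.IH[OF S'(4)])
      show "\<exists>v\<in>T. card {u \<in> T. E v u} \<le> d - 1" if "T \<subseteq> S'" "T \<noteq> {}" for T
        using psubset.prems(1)[of T] that S'(4) by auto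
    qed (use psubset.prems(2,3) S'(4) proper_on_subset in \<open>blast+\<close>)
    then obtain s where s: "legal k E S' \<alpha> s" "\<forall>x\<in>S'. run \<alpha> s x = \<beta> x"
      "\<forall>u\<in>S'. times_recolored s u \<le> d" by blast
    have deg: "card {u \<in> S'. E v u} \<le> d - 1"
      using card_mono[of "{u \<in> S. E v u}" "{u \<in> S'. E v u}"] v(2) psubset.hyps S'(4) by force
    have "length (neighbor_targets E v s) \<le> (d - 1) * d"
      using length_neighbor_targets_le[OF legal_vertices[OF s(1)] S'(3), of E v "d - 1" d] deg s(3)
      by auto
    moreover obtain s' where s': "legal k E S \<alpha> s'" "\<forall>x\<in>S'. run \<alpha> s' x = \<beta> x"
      "\<forall>u\<in>S'. times_recolored s' u \<le> d"
      "times_recolored s' v * d \<le> length (neighbor_targets E v s) + (d - 1)"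
      using extend_recoloring[OF assms(1) S'(3,2) deg assms(3,4) s(1), of \<alpha> 0] s(2,3) S'(1) by auto
    ultimately have "times_recolored s' v * d < (d - 1) * d + d"
      using \<open>d \<ge> 1\<close> by linarith
    also have "\<dots> = d * d" using \<open>d \<ge> 1\<close> by (simp add: algebra_simps)
    finally have count: "times_recolored s' v < d" by simp
    show ?thesis
    proof (cases "run \<alpha> s' v = \<beta> v")
      case True
      then show ?thesis using s' count S'(1) by (intro exI[of _ s']) auto
    next
      case False
      \<comment> \<open>The neighbors of \<open>v\<close> already have their colors under \<open>\<beta>\<close>, which is proper.\<close>
      have "\<beta> v \<in> {1..k}" "\<forall>u\<in>S'. E v u \<longrightarrow> \<beta> u \<noteq> \<beta> v"
        using psubset.prems(3) S'(1) unfolding proper_on_def by (blast, force)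
      then have "legal k E S \<alpha> (s' @ [(v, \<beta> v)])"
        using s'(1,2) False S'(1) by (auto simp: legal_append)
      then show ?thesis
        using s'(2,3) count S'(1,2)
        by (intro exI[of _ "s' @ [(v, \<beta> v)]"]) (auto simp: run_append)
    qed
  qed
qed

text \<open>
  Only the induced subgraphs of a degenerate graph enter the induction, so degeneracy is transferred
  to the vertex sets \<open>T\<close>.
\<close>

lemma degenerate_small_degree:
  assumes "graph G" "degenerate m G" "T \<subseteq> verts G" "T \<noteq> {}"
  shows "\<exists>v\<in>T. card {u \<in> T. v \<rightarrow>\<^bsub>G\<^esub> u} \<le> m"
proof -
  interpret G: graph G by fact
  let ?H = "G \<restriction> T"
  have ind: "induced_subgraph ?H G"
    using assms(3) by (rule G.induced_induce)
  have "graph ?H"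
  proof -
    interpret H: digraph ?H using ind by (rule G.digraphI_induced)
    show ?thesis
    proof
      show "symmetric ?H"
        unfolding symmetric_conv
      proof
        fix e1 assume e1: "e1 \<in> arcs ?H"
        then obtain e2 where "e2 \<in> arcs G" "tail G e1 = head G e2" "head G e1 = tail G e2"
          using G.sym_arcs unfolding symmetric_conv by (auto simp: induce_subgraph_arcs)
        with e1 show "\<exists>e2\<in>arcs ?H. tail ?H e1 = head ?H e2 \<and> head ?H e1 = tail ?H e2"
          by (intro bexI[of _ e2]) auto
      qed
    qed
  qed
  moreover have "subgraph ?H G" using ind by (rule induced_imp_subgraph)
  ultimately obtain v where v: "v \<in> T" "out_degree ?H v \<le> m"
    using assms(2,4) unfolding degenerate_def by force
  interpret H: graph ?H by fact
  have "{u \<in> T. v \<rightarrow>\<^bsub>G\<^esub> u} \<subseteq> head G ` out_arcs ?H v"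
    using v(1) by (auto simp: arcs_ends_def arc_to_ends_def intro!: image_eqI)
  then have "card {u \<in> T. v \<rightarrow>\<^bsub>G\<^esub> u} \<le> card (head G ` out_arcs ?H v)"
    by (intro card_mono) auto
  also have "\<dots> \<le> out_degree ?H v"
    unfolding out_degree_def by (intro card_image_le) auto
  finally show ?thesis using v by force
qed

section \<open>Walks in the recoloring graph\<close>

fun steps_to_arcs ::
  "('a \<Rightarrow> nat) \<Rightarrow> ('a \<times> nat) list \<Rightarrow> (('a \<Rightarrow> nat) \<times> ('a \<Rightarrow> nat)) list" where
  "steps_to_arcs f [] = []"
| "steps_to_arcs f ((w, a) # s) = (f, f(w := a)) # steps_to_arcs (f(w := a)) s"

lemma length_steps_to_arcs: "length (steps_to_arcs f s) = length s"
  by (induction s arbitrary: f) auto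

lemma recolor_count_steps_to_arcs:
  "legal k E S f s \<Longrightarrow> recolor_count v (steps_to_arcs f s) = times_recolored s v"
  by (induction s arbitrary: f) (auto simp: recolor_count_def)

lemma proper_colorings_iff:
  assumes "graph G"
  shows "f \<in> proper_colorings k G \<longleftrightarrow>
    f \<in> extensional (verts G) \<and> proper_on k (\<lambda>x y. x \<rightarrow>\<^bsub>G\<^esub> y) (verts G) f"
proof -
  interpret G: graph G by fact
  have edges: "(\<forall>x y. x \<rightarrow>\<^bsub>G\<^esub> y \<longrightarrow> f x \<noteq> f y) \<longleftrightarrow>
      (\<forall>x\<in>verts G. \<forall>y\<in>verts G. x \<rightarrow>\<^bsub>G\<^esub> y \<longrightarrow> f x \<noteq> f y)"
    using G.adj_in_verts by blast
  then show ?thesis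
    unfolding proper_colorings_def proper_on_def mem_Collect_eq PiE_iff image_subset_iff edges
    by blast
qed

lemma awalk_steps_to_arcs:
  assumes "graph G" "f \<in> proper_colorings k G" "legal k (\<lambda>x y. x \<rightarrow>\<^bsub>G\<^esub> y) (verts G) f s"
  shows "pre_digraph.awalk (recoloring_graph k G) f (steps_to_arcs f s) (run f s)"
  using assms(2,3)
proof (induction s arbitrary: f)
  interpret G: graph G by fact
  interpret R: graph "recoloring_graph k G" by (rule graph_recoloring_graph) fact
  case Nil
  then show ?case by (simp add: R.awalk_Nil_iff) (simp add: recoloring_graph_def)
next
  interpret G: graph G by fact
  interpret R: graph "recoloring_graph k G" by (rule graph_recoloring_graph) fact
  case (Cons step s)
  obtain w a where step: "step = (w, a)" by (cases step)
  let ?g = "f(w := a)"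
  have w: "w \<in> verts G" "a \<in> {1..k}" "f w \<noteq> a" "\<forall>u\<in>verts G. w \<rightarrow>\<^bsub>G\<^esub> u \<longrightarrow> f u \<noteq> a"
    "legal k (\<lambda>x y. x \<rightarrow>\<^bsub>G\<^esub> y) (verts G) ?g s"
    using Cons.prems(2) step by auto
  have sym: "y \<rightarrow>\<^bsub>G\<^esub> x" if "x \<rightarrow>\<^bsub>G\<^esub> y" for x y
    using that by (rule G.graph_symmetric)
  have f: "f \<in> extensional (verts G)" "proper_on k (\<lambda>x y. x \<rightarrow>\<^bsub>G\<^esub> y) (verts G) f"
    using Cons.prems(1) by (simp_all only: proper_colorings_iff[OF assms(1)])
  have "proper_on k (\<lambda>x y. x \<rightarrow>\<^bsub>G\<^esub> y) (verts G) ?g"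
    unfolding proper_on_def
  proof (intro conjI ballI impI)
    show "?g ` verts G \<subseteq> {1..k}"
      using f(2) w(2) unfolding proper_on_def image_subset_iff by simp
  next
    fix x y assume xy: "x \<in> verts G" "y \<in> verts G" "x \<rightarrow>\<^bsub>G\<^esub> y"
    then have "f x \<noteq> f y" using f(2) unfolding proper_on_def by blast
    with xy w(4) sym[OF xy(3)] show "?g x \<noteq> ?g y" by (auto simp: fun_upd_apply)
  qed
  moreover have "?g \<in> extensional (verts G)"
    using f(1) w(1) by (auto simp: extensional_def)
  ultimately have g: "?g \<in> proper_colorings k G"
    by (simp only: proper_colorings_iff[OF assms(1)])
  have "(f, ?g) \<in> arcs (recoloring_graph k G)"
    using Cons.prems(1) g w(1,3) by (auto simp: recoloring_graph_def)
  moreover have "R.awalk ?g (steps_to_arcs ?g s) (run ?g s)"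
    by (rule Cons.IH[OF g w(5)])
  ultimately show ?case
    by (simp add: step R.awalk_Cons_iff) (simp add: recoloring_graph_def)
qed

theorem theorem1:
  fixes G :: "('a, 'b) pre_digraph" and d k :: nat
  assumes "graph G"
    and "d \<ge> 1"
    and "degenerate (d - 1) G"
    and "k \<ge> 2 * d"
  shows "diam (recoloring_graph k G) \<le> ereal (real (d * card (verts G))) \<and>
    (\<forall>\<alpha> \<in> proper_colorings k G. \<forall>\<beta> \<in> proper_colorings k G.
      \<exists>p. pre_digraph.awalk (recoloring_graph k G) \<alpha> p \<beta> \<and>
          (\<forall>v \<in> verts G. recolor_count v p \<le> d))"
proof -
  interpret G: graph G by fact
  interpret R: graph "recoloring_graph k G" by (rule graph_recoloring_graph) fact
  have walk: "\<exists>p. R.awalk \<alpha> p \<beta> \<and> (\<forall>v \<in> verts G. recolor_count v p \<le> d) \<and>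
      length p \<le> d * card (verts G)"
    if \<alpha>: "\<alpha> \<in> proper_colorings k G" and \<beta>: "\<beta> \<in> proper_colorings k G" for \<alpha> \<beta>
  proof -
    let ?E = "\<lambda>x y. x \<rightarrow>\<^bsub>G\<^esub> y"
    have "symp ?E" by (rule sympI) (rule G.graph_symmetric)
    moreover have "proper_on k ?E (verts G) \<alpha>" "proper_on k ?E (verts G) \<beta>"
      using \<alpha> \<beta> by (simp_all only: proper_colorings_iff[OF assms(1)])
    ultimately obtain s where s: "legal k ?E (verts G) \<alpha> s" "\<forall>x\<in>verts G. run \<alpha> s x = \<beta> x"
      "\<forall>v\<in>verts G. times_recolored s v \<le> d"
      using recoloring_sequence_exists[OF _ G.finite_verts assms(2,4)
          degenerate_small_degree[OF assms(1,3)], of \<alpha> \<beta>]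
      by blast
    have vs: "fst ` set s \<subseteq> verts G" using s(1) by (rule legal_vertices)
    \<comment> \<open>Off the vertex set both sides are \<^const>\<open>undefined\<close>, as no step touches it.\<close>
    have "run \<alpha> s = \<beta>"
    proof
      fix x
      show "run \<alpha> s x = \<beta> x"
      proof (cases "x \<in> verts G")
        case False
        then have "run \<alpha> s x = \<alpha> x" using vs by (intro run_outside) auto
        then show ?thesis
          using False \<alpha> \<beta> by (simp add: proper_colorings_iff[OF assms(1)] extensional_def)
      qed (use s(2) in auto)
    qed
    then have "R.awalk \<alpha> (steps_to_arcs \<alpha> s) \<beta>"
      using awalk_steps_to_arcs[OF assms(1) \<alpha> s(1)] by simp
    moreover have "\<forall>v\<in>verts G. recolor_count v (steps_to_arcs \<alpha> s) \<le> d"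
      using s(3) recolor_count_steps_to_arcs[OF s(1)] by simp
    moreover have "length s \<le> d * card (verts G)"
    proof -
      have "length s = (\<Sum>v\<in>verts G. times_recolored s v)"
        using sum_count_set[of "map fst s" "verts G"] vs by simp
      also have "\<dots> \<le> d * card (verts G)"
        using sum_mono[of "verts G" "times_recolored s" "\<lambda>_. d"] s(3) by (simp add: mult.commute)
      finally show ?thesis .
    qed
    ultimately show ?thesis using length_steps_to_arcs by metis
  qed
  have "R.\<mu> (\<lambda>_. 1) \<alpha> \<beta> \<le> ereal (real (d * card (verts G)))"
    if "\<alpha> \<in> proper_colorings k G" "\<beta> \<in> proper_colorings k G" for \<alpha> \<beta>
  proof -
    obtain p where p: "R.awalk \<alpha> p \<beta>" "length p \<le> d * card (verts G)"
      using walk[OF \<open>\<alpha> \<in> _\<close> \<open>\<beta> \<in> _\<close>] by blast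
    have "R.\<mu> (\<lambda>_. 1) \<alpha> \<beta> \<le> R.awalk_cost (\<lambda>_. 1) p"
      using p(1) by (rule R.min_cost_le_walk_cost)
    also have "R.awalk_cost (\<lambda>_. 1) p = real (length p)"
      by (induction p) auto
    also have "ereal (real (length p)) \<le> ereal (real (d * card (verts G)))"
      using p(2) by (simp only: ereal_less_eq of_nat_le_iff)
    finally show ?thesis .
  qed
  then have "diam (recoloring_graph k G) \<le> ereal (real (d * card (verts G)))"
    unfolding diam_def by (auto simp: recoloring_graph_def intro!: SUP_least)
  with walk show ?thesis by blast
qed

end
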